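(* For every $n\ge 1$, $$\mathcal{Q}^n=\bigcup_{x\in\Delta_n}\mathcal{Q}_x=\bigcup_{x\in\Delta_n}\left(\mathcal{P}_x+\mathcal{N}_x+\mathcal{L}\right),$$ where $+$ denotes Minkowski sum.
   Context: $\mathcal{S}^n$ is the space of real symmetric $n\times n$ matrices, with trace inner product $\langle U,V\rangle=\sum_{i,j}U_{ij}V_{ij}$; $e\in\mathbb{R}^n$ is the all-ones vector, $E=ee^T$; $\Delta_n=\{x\in\mathbb{R}^n: e^Tx=1,\ x\ge 0\}$. $\mathcal{PSD}^n$ is the cone of positive semidefinite matrices in $\mathcal{S}^n$, $\mathcal{N}^n$ the cone of entrywise nonnegative matrices in $\mathcal{S}^n$, and $\mathcal{DN}^n=\mathcal{PSD}^n\cap\mathcal{N}^n$. For $Q\in\mathcal{S}^n$: $\nu(Q)=\min\{x^TQx: x\in\Delta_n\}$, $\Omega(Q)=\{x\in\Delta_n: x^TQx=\nu(Q)\}$, and $\ell(Q)=\min\{\langle Q,X\rangle:\langle E,X\rangle=1,\ X\in\mathcal{DN}^n\}$. $\mathcal{Q}^n=\{Q\in\mathcal{S}^n:\ell(Q)=\nu(Q)\}$. For $x\in\Delta_n$: $\mathcal{Q}_x=\{Q\in\mathcal{S}^n: x\in\Omega(Q),\ \ell(Q)=\nu(Q)\}$; $\mathcal{P}_x=\{P\in\mathcal{PSD}^n: x^TPx=0\}$; $\mathcal{N}_x=\{N\in\mathcal{N}^n: x^TNx=0\}$. Also $\mathcal{L}=\{\lambda E:\lambda\in\mathbb{R}\}$.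 *)

theory Defs
  imports "HOL-Analysis.Analysis" "HOL-Library.Set_Algebras"
begin

definition sym_mats :: "(real^'n^'n) set" where
  "sym_mats = {A. transpose A = A}"

definition all_ones_vec :: "real^'n" where
  "all_ones_vec = (\<chi> i. 1)"

definition all_ones_mat :: "real^'n^'n" where
  "all_ones_mat = (\<chi> i j. 1)"

definition std_simplex :: "(real^'n) set" where
  "std_simplex = {x. all_ones_vec \<bullet> x = 1 \<and> (\<forall>i. 0 \<le> x $ i)}"

abbreviation quad_form :: "real^'n^'n \<Rightarrow> real^'n \<Rightarrow> real" where
  "quad_form A x \<equiv> x \<bullet> (A *v x)"

definition psd_cone :: "(real^'n^'n) set" where
  "psd_cone = {A \<in> sym_mats. \<forall>x. 0 \<le> quad_form A x}"

definition nonneg_cone :: "(real^'n^'n) set" where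
  "nonneg_cone = {A \<in> sym_mats. \<forall>i j. 0 \<le> A $ i $ j}"

definition dn_cone :: "(real^'n^'n) set" where
  "dn_cone = psd_cone \<inter> nonneg_cone"

text \<open>
  Both optimal values below are minima: \<open>LEAST\<close> picks the smallest element of the set of
  objective values, and the lemmas \<open>nu_attained\<close> and \<open>ell_attained\<close> show that it exists.
  The library inner product on nested vectors is the trace inner product
  (\<open>trace_inner\<close>).
\<close>

definition nu :: "real^'n^'n \<Rightarrow> real" where
  "nu Q = (LEAST v. v \<in> (\<lambda>x. quad_form Q x) ` std_simplex)"

definition argmin_set :: "real^'n^'n \<Rightarrow> (real^'n) set" where
  "argmin_set Q = {x \<in> std_simplex. quad_form Q x = nu Q}"

definition ell_feasible :: "(real^'n^'n) set" where
  "ell_feasible = {X \<in> dn_cone. all_ones_mat \<bullet> X = 1}"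

definition ell :: "real^'n^'n \<Rightarrow> real" where
  "ell Q = (LEAST v. v \<in> (\<lambda>X. Q \<bullet> X) ` ell_feasible)"

definition exact_mats :: "(real^'n^'n) set" where
  "exact_mats = {Q \<in> sym_mats. ell Q = nu Q}"

definition exact_mats_at :: "real^'n \<Rightarrow> (real^'n^'n) set" where
  "exact_mats_at x = {Q \<in> sym_mats. x \<in> argmin_set Q \<and> ell Q = nu Q}"

definition psd_at :: "real^'n \<Rightarrow> (real^'n^'n) set" where
  "psd_at x = {P \<in> psd_cone. quad_form P x = 0}"

definition nonneg_at :: "real^'n \<Rightarrow> (real^'n^'n) set" where
  "nonneg_at x = {N \<in> nonneg_cone. quad_form N x = 0}"

definition ones_line :: "(real^'n^'n) set" where
  "ones_line = {c *\<^sub>R all_ones_mat | c. True}"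

lemma trace_inner:
  fixes U V :: "real^'n^'n"
  shows "U \<bullet> V = (\<Sum>i\<in>UNIV. \<Sum>j\<in>UNIV. U $ i $ j * V $ i $ j)"
  by (simp add: inner_vec_def)

lemma Least_image_attained:
  fixes f :: "'a::topological_space \<Rightarrow> real"
  assumes "compact S" "S \<noteq> {}" "continuous_on S f"
  shows "\<exists>x\<in>S. f x = (LEAST v. v \<in> f ` S) \<and> (\<forall>y\<in>S. f x \<le> f y)"
proof -
  obtain x where x: "x \<in> S" "\<forall>y\<in>S. f x \<le> f y"
    using continuous_attains_inf[OF assms] by blast
  have "(LEAST v. v \<in> f ` S) = f x"
    by (rule Least_equality) (use x in auto)
  with x show ?thesis by auto
qed

lemma compact_std_simplex: "compact (std_simplex :: (real^'n) set)"
proof (rule compact_eq_bounded_closed[THEN iffD2], intro conjI)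
  have "norm x \<le> 1" if "x \<in> std_simplex" for x :: "real^'n"
  proof -
    have "norm x \<le> (\<Sum>i\<in>UNIV. \<bar>x $ i\<bar>)" by (rule norm_le_l1_cart)
    also have "\<dots> = 1"
      using that by (simp add: std_simplex_def all_ones_vec_def inner_vec_def)
    finally show ?thesis .
  qed
  then show "bounded (std_simplex :: (real^'n) set)" unfolding bounded_iff by blast
  show "closed (std_simplex :: (real^'n) set)"
    unfolding std_simplex_def
    by (intro closed_Collect_conj closed_Collect_all closed_Collect_eq closed_Collect_le
        continuous_intros)
qed

lemma std_simplex_nonempty: "(std_simplex :: (real^'n) set) \<noteq> {}"
proof -
  have "axis undefined 1 \<in> (std_simplex :: (real^'n) set)"
    by (simp add: std_simplex_def all_ones_vec_def inner_axis) (simp add: axis_def)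
  then show ?thesis by blast
qed

lemma nu_attained:
  fixes Q :: "real^'n^'n"
  shows "\<exists>x\<in>std_simplex. quad_form Q x = nu Q \<and> (\<forall>y\<in>std_simplex. quad_form Q x \<le> quad_form Q y)"
  unfolding nu_def
  by (rule Least_image_attained[OF compact_std_simplex std_simplex_nonempty])
     (intro continuous_intros matrix_vector_mult_linear_continuous_on)

lemma ell_feasible_nonempty: "(ell_feasible :: (real^'n^'n) set) \<noteq> {}"
proof -
  define X :: "real^'n^'n" where "X = axis undefined (axis undefined 1)"
  have e: "X $ i $ j = (if i = undefined \<and> j = undefined then 1 else 0)" for i j
    by (auto simp: X_def axis_def)
  have mv: "X *v x = axis undefined (x $ undefined)" for x
    by (auto simp: vec_eq_iff matrix_vector_mult_def e axis_def if_distrib if_distribR cong: if_cong)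
  have "X \<in> ell_feasible"
    by (auto simp: ell_feasible_def dn_cone_def psd_cone_def nonneg_cone_def sym_mats_def
        transpose_def vec_eq_iff e mv inner_axis)
       (simp add: all_ones_mat_def X_def inner_axis)
  then show ?thesis by blast
qed

lemma compact_ell_feasible: "compact (ell_feasible :: (real^'n^'n) set)"
proof (rule compact_eq_bounded_closed[THEN iffD2], intro conjI)
  have "norm X \<le> 1" if "X \<in> ell_feasible" for X :: "real^'n^'n"
  proof -
    have "norm X \<le> (\<Sum>i\<in>UNIV. norm (X $ i))"
      unfolding norm_vec_def by (rule L2_set_le_sum) simp
    also have "\<dots> \<le> (\<Sum>i\<in>UNIV. \<Sum>j\<in>UNIV. \<bar>X $ i $ j\<bar>)"
      by (intro sum_mono norm_le_l1_cart)
    also have "\<dots> = 1"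
      using that by (simp add: ell_feasible_def dn_cone_def nonneg_cone_def all_ones_mat_def inner_vec_def)
    finally show ?thesis .
  qed
  then show "bounded (ell_feasible :: (real^'n^'n) set)" unfolding bounded_iff by blast
  have "ell_feasible = {X :: real^'n^'n. (\<forall>i j. X $ j $ i = X $ i $ j) \<and>
      (\<forall>x. 0 \<le> (\<Sum>i\<in>UNIV. x $ i * (\<Sum>j\<in>UNIV. X $ i $ j * x $ j))) \<and>
      (\<forall>i j. 0 \<le> X $ i $ j) \<and> all_ones_mat \<bullet> X = 1}"
    by (auto simp: ell_feasible_def dn_cone_def psd_cone_def nonneg_cone_def sym_mats_def
        transpose_def vec_eq_iff inner_vec_def matrix_vector_mult_def)
  moreover have "closed \<dots>"
    by (intro closed_Collect_conj closed_Collect_all closed_Collect_eq closed_Collect_le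
        continuous_intros)
  ultimately show "closed (ell_feasible :: (real^'n^'n) set)" by simp
qed

lemma ell_attained:
  fixes Q :: "real^'n^'n"
  shows "\<exists>X\<in>ell_feasible. Q \<bullet> X = ell Q \<and> (\<forall>Y\<in>ell_feasible. Q \<bullet> X \<le> Q \<bullet> Y)"
  unfolding ell_def
  by (rule Least_image_attained[OF compact_ell_feasible ell_feasible_nonempty])
     (intro continuous_intros)

end

theory Submission
  imports Defs
begin

text \<open>
  The first equality only needs a minimiser of the quadratic form on the simplex to exist
  (\<open>nu_attained\<close>). The second is an instance of conic duality.

  For a matrix \<open>Q\<close> whose relaxation is exact, let \<open>c\<close> be the common value of the two minima. The rank one matrices
  \<open>x x\<^sup>T\<close> with \<open>x\<close> in the simplex are feasible for the relaxation and give \<open>ell Q \<le> nu Q\<close>.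
  Equality of the two values says that \<open>Q - c E\<close> has nonnegative inner product with every doubly
  nonnegative matrix. The dual of the doubly nonnegative cone is \<open>psd_cone + nonneg_cone\<close>
  (\<open>dn_dual_decomposition\<close>), so \<open>Q - c E = P + N\<close>. At a minimiser \<open>x\<close> the quadratic form of the
  left-hand side vanishes, whereas those of \<open>P\<close> and \<open>N\<close> are nonnegative; hence both vanish.
  Conversely, for \<open>Q = P + N + c E\<close> with \<open>P\<close> and \<open>N\<close> vanishing at \<open>x\<close>, the value \<open>c\<close> is attained
  at \<open>x\<close> and is a lower bound for the relaxation, because positive semidefinite matrices have
  nonnegative inner products with each other (\<open>psd_inner_nonneg\<close>).

  The duality statement is proved by separation. This requires \<open>psd_cone + nonneg_cone\<close> to be
  closed, which holds because the diagonal of the sum bounds the positive semidefinite summand.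
\<close>

definition outer :: "real^'n \<Rightarrow> real^'n \<Rightarrow> real^'n^'n" where
  "outer v w = (\<chi> i j. v $ i * w $ j)"

lemma outer_nth [simp]: "outer v w $ i $ j = v $ i * w $ j"
  by (simp add: outer_def)

lemma inner_outer: "A \<bullet> outer v w = v \<bullet> (A *v w)"
  by (simp add: trace_inner inner_vec_def matrix_vector_mult_def sum_distrib_left mult_ac)

lemma quad_form_outer: "quad_form A x = A \<bullet> outer x x"
  by (simp add: inner_outer)

lemma quad_form_add: "quad_form (A + B) x = quad_form A x + quad_form B x"
  by (simp add: quad_form_outer inner_add_left)

lemma inner_transpose:
  fixes A B :: "real^'n^'n"
  shows "transpose A \<bullet> B = A \<bullet> transpose B"
  unfolding trace_inner by (subst sum.swap) (simp add: transpose_def)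

lemma sym_mats_iff: "A \<in> sym_mats \<longleftrightarrow> (\<forall>i j. A $ i $ j = A $ j $ i)"
  by (auto simp: sym_mats_def transpose_def vec_eq_iff)

lemma psd_cone_iff: "A \<in> psd_cone \<longleftrightarrow> A \<in> sym_mats \<and> (\<forall>x. 0 \<le> A \<bullet> outer x x)"
  by (simp add: psd_cone_def quad_form_outer)

lemma outer_psd: "outer x x \<in> psd_cone"
proof -
  have "outer x x \<bullet> outer y y = (x \<bullet> y)\<^sup>2" for y :: "real^'a"
    by (simp add: trace_inner inner_vec_def power2_eq_square sum_product mult_ac)
  then show ?thesis
    by (simp add: psd_cone_iff sym_mats_iff mult_ac)
qed

lemma psd_scaleR: "A \<in> psd_cone \<Longrightarrow> 0 \<le> c \<Longrightarrow> c *\<^sub>R A \<in> psd_cone"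
  by (simp add: psd_cone_iff sym_mats_iff)

lemma nonneg_scaleR: "A \<in> nonneg_cone \<Longrightarrow> 0 \<le> c \<Longrightarrow> c *\<^sub>R A \<in> nonneg_cone"
  by (simp add: nonneg_cone_def sym_mats_iff)

lemma zero_psd: "0 \<in> psd_cone"
  by (simp add: psd_cone_iff sym_mats_iff)

lemma zero_nonneg: "0 \<in> nonneg_cone"
  by (simp add: nonneg_cone_def sym_mats_iff)

lemma nonneg_inner_nonneg:
  assumes "\<And>i j. 0 \<le> A $ i $ j" "\<And>i j. 0 \<le> B $ i $ j"
  shows "0 \<le> A \<bullet> (B :: real^'n^'n)"
  unfolding trace_inner by (intro sum_nonneg mult_nonneg_nonneg assms)

section \<open>Inner products of positive semidefinite matrices\<close>

lemma quad_form_shift_axis: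
  assumes "X \<in> sym_mats"
  shows "quad_form X (x + t *\<^sub>R axis i 1) = quad_form X x + 2 * t * (X $ i \<bullet> x) + t\<^sup>2 * X $ i $ i"
proof -
  have i: "(X *v y) $ i = X $ i \<bullet> y" for y
    by (simp add: matrix_vector_mult_def inner_vec_def)
  have "x \<bullet> (X *v axis i 1) = X $ i \<bullet> x"
    using assms by (simp add: sym_mats_iff inner_vec_def matrix_vector_mult_def axis_def
        if_distrib if_distribR mult_ac cong: if_cong)
  moreover have "axis i 1 \<bullet> (X *v y) = X $ i \<bullet> y" for y
    by (simp add: inner_axis' i)
  moreover have "X $ i \<bullet> axis i 1 = X $ i $ i"
    by (simp add: inner_axis)
  ultimately show ?thesis
    by (simp add: matrix_vector_right_distrib matrix_vector_mult_scaleR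
        inner_add_left inner_add_right algebra_simps power2_eq_square)
qed

lemma psd_diag_nonneg: "X \<in> psd_cone \<Longrightarrow> 0 \<le> X $ i $ i"
  using quad_form_shift_axis[of X 0 1 i] by (auto simp: psd_cone_def dest: spec[of _ "axis i 1"])

text \<open>
  A quadratic polynomial in the shift along the \<open>i\<close>-th axis is nonnegative everywhere, so it has
  no linear term once its quadratic term is absent.
\<close>

lemma psd_zero_diag_row:
  assumes "X \<in> psd_cone" "X $ i $ i = 0"
  shows "X $ i = 0"
proof -
  define y where "y = X $ i"
  define t where "t = - (quad_form X y + 1) / (2 * (y \<bullet> y))"
  have "0 \<le> quad_form X (y + t *\<^sub>R axis i 1)"
    using assms(1) by (simp add: psd_cone_def)
  also have "\<dots> = quad_form X y + 2 * t * (y \<bullet> y)"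
    using assms quad_form_shift_axis[of X y t i] by (simp add: y_def psd_cone_def)
  finally have "0 \<le> quad_form X y + 2 * t * (y \<bullet> y)" .
  then have "y \<bullet> y = 0"
    by (cases "y \<bullet> y = 0") (auto simp: t_def field_simps)
  then show ?thesis by (simp add: y_def)
qed

text \<open>
  The Schur complement: eliminating the variable \<open>i\<close> from the quadratic form amounts to minimising
  it along the \<open>i\<close>-th axis, which keeps it nonnegative.
\<close>

lemma psd_schur_complement:
  assumes X: "X \<in> psd_cone" and pos: "X $ i $ i > 0"
  shows "X - (1 / X $ i $ i) *\<^sub>R outer (X $ i) (X $ i) \<in> psd_cone"
proof -
  have sym: "X \<in> sym_mats" using X by (simp add: psd_cone_def)
  have "0 \<le> (X - (1 / X $ i $ i) *\<^sub>R outer (X $ i) (X $ i)) \<bullet> outer x x" for x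
  proof -
    define t where "t = - (X $ i \<bullet> x) / X $ i $ i"
    have "outer (X $ i) (X $ i) \<bullet> outer x x = (X $ i \<bullet> x)\<^sup>2"
      by (simp add: trace_inner inner_vec_def power2_eq_square sum_product mult_ac)
    then have "(X - (1 / X $ i $ i) *\<^sub>R outer (X $ i) (X $ i)) \<bullet> outer x x
        = quad_form X x - (X $ i \<bullet> x)\<^sup>2 / X $ i $ i"
      by (simp add: inner_diff_left quad_form_outer)
    also have "\<dots> = quad_form X (x + t *\<^sub>R axis i 1)"
      unfolding quad_form_shift_axis[OF sym]
      using pos by (simp add: t_def field_simps power2_eq_square)
    also have "\<dots> \<ge> 0" using X by (simp add: psd_cone_def)
    finally show ?thesis .
  qed
  moreover have "X - (1 / X $ i $ i) *\<^sub>R outer (X $ i) (X $ i) \<in> sym_mats"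
    using sym by (simp add: sym_mats_iff mult_ac)
  ultimately show ?thesis by (simp add: psd_cone_iff)
qed

text \<open>
  Splitting off one rank one term per step writes \<open>X\<close> as a sum of matrices \<open>v v\<^sup>T\<close>, each of which
  contributes \<open>v\<^sup>T P v \<ge> 0\<close>. The induction runs over the set of rows that may still be nonzero.
\<close>

lemma psd_inner_nonneg:
  fixes P X :: "real^'n^'n"
  assumes P: "P \<in> psd_cone" and X: "X \<in> psd_cone"
  shows "0 \<le> P \<bullet> X"
proof -
  have "0 \<le> P \<bullet> X" if "finite S" "X \<in> psd_cone" "\<And>j. j \<notin> S \<Longrightarrow> X $ j = 0"
    for S and X :: "real^'n^'n"
    using that
  proof (induction S arbitrary: X rule: finite_induct)
    case empty
    then have "X = 0" by (simp add: vec_eq_iff)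
    then show ?case by simp
  next
    case (insert i S)
    show ?case
    proof (cases "X $ i $ i = 0")
      case True
      then have "X $ i = 0" using psd_zero_diag_row insert.prems(1) by blast
      then have "\<And>j. j \<notin> S \<Longrightarrow> X $ j = 0" using insert.prems(2) by (metis insertE)
      then show ?thesis using insert.IH insert.prems(1) by blast
    next
      case False
      then have pos: "X $ i $ i > 0" using psd_diag_nonneg[OF insert.prems(1), of i] by simp
      define Y where "Y = X - (1 / X $ i $ i) *\<^sub>R outer (X $ i) (X $ i)"
      have Y: "Y \<in> psd_cone"
        unfolding Y_def by (rule psd_schur_complement[OF insert.prems(1) pos])
      have "Y $ j = 0" if "j \<notin> S" for j
      proof (cases "j = i")
        case True
        then show ?thesis using pos by (simp add: Y_def vec_eq_iff)
      next
        case False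
        then have "X $ j = 0" using that insert.prems(2) by simp
        moreover have "X $ i $ j = X $ j $ i"
          using insert.prems(1) unfolding psd_cone_def sym_mats_iff by blast
        ultimately show ?thesis by (simp add: Y_def vec_eq_iff)
      qed
      then have "0 \<le> P \<bullet> Y" using insert.IH Y by blast
      moreover have "0 \<le> (1 / X $ i $ i) * (P \<bullet> outer (X $ i) (X $ i))"
        using P pos by (simp add: psd_cone_iff)
      moreover have "P \<bullet> X = P \<bullet> Y + (1 / X $ i $ i) * (P \<bullet> outer (X $ i) (X $ i))"
        by (simp add: Y_def inner_diff_right)
      ultimately show ?thesis by simp
    qed
  qed
  from this[of UNIV X] X show ?thesis by simp
qed

section \<open>The dual of the doubly nonnegative cone\<close>

lemma closed_psd_cone: "closed (psd_cone :: (real^'n^'n) set)"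
proof -
  have "psd_cone = {A :: real^'n^'n. (\<forall>i j. A $ i $ j = A $ j $ i) \<and> (\<forall>x. 0 \<le> A \<bullet> outer x x)}"
    by (auto simp: psd_cone_iff sym_mats_iff)
  also have "closed \<dots>"
    by (intro closed_Collect_conj closed_Collect_all closed_Collect_eq closed_Collect_le
        continuous_intros)
  finally show ?thesis .
qed

lemma closed_nonneg_cone: "closed (nonneg_cone :: (real^'n^'n) set)"
proof -
  have "nonneg_cone = {A :: real^'n^'n. (\<forall>i j. A $ i $ j = A $ j $ i) \<and> (\<forall>i j. 0 \<le> A $ i $ j)}"
    by (auto simp: nonneg_cone_def sym_mats_iff)
  also have "closed \<dots>"
    by (intro closed_Collect_conj closed_Collect_all closed_Collect_eq closed_Collect_le
        continuous_intros)
  finally show ?thesis .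
qed

lemma convex_psd_cone: "convex (psd_cone :: (real^'n^'n) set)"
  by (rule convexI) (simp add: psd_cone_iff sym_mats_iff inner_add_left)

lemma convex_nonneg_cone: "convex (nonneg_cone :: (real^'n^'n) set)"
  by (rule convexI) (simp add: nonneg_cone_def sym_mats_iff)

text \<open>Testing the quadratic form on \<open>e\<^sub>i + e\<^sub>j\<close> and \<open>e\<^sub>i - e\<^sub>j\<close> bounds the entry \<open>(i, j)\<close>.\<close>

lemma psd_entry_bound:
  assumes "P \<in> psd_cone"
  shows "2 * \<bar>P $ i $ j\<bar> \<le> P $ i $ i + P $ j $ j"
proof -
  have sym: "P \<in> sym_mats" using assms by (simp add: psd_cone_def)
  have j: "quad_form P (axis j 1) = P $ j $ j"
    using quad_form_shift_axis[OF sym, of 0 1 j] by simp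
  have "0 \<le> P $ j $ j + 2 * t * P $ i $ j + t\<^sup>2 * P $ i $ i" for t
    using assms quad_form_shift_axis[OF sym, of "axis j 1" t i] j
    by (simp add: psd_cone_def inner_axis) (metis (no_types, lifting))
  from this[of 1] this[of "-1"] show ?thesis by simp
qed

lemma psd_norm_bound:
  fixes P :: "real^'n^'n"
  assumes P: "P \<in> psd_cone" and diag: "\<And>i. P $ i $ i \<le> b"
  shows "norm P \<le> of_nat CARD('n) * (of_nat CARD('n) * b)"
proof -
  have entry: "\<bar>P $ i $ j\<bar> \<le> b" for i j
    using psd_entry_bound[OF P, of i j] diag[of i] diag[of j] by linarith
  have "norm P \<le> (\<Sum>i\<in>UNIV. norm (P $ i))"
    unfolding norm_vec_def by (rule L2_set_le_sum) simp
  also have "\<dots> \<le> (\<Sum>i\<in>UNIV. \<Sum>j\<in>UNIV. \<bar>P $ i $ j\<bar>)"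
    by (intro sum_mono norm_le_l1_cart)
  also have "\<dots> \<le> (\<Sum>i\<in>(UNIV::'n set). \<Sum>j\<in>(UNIV::'n set). b)"
    by (intro sum_mono entry)
  finally show ?thesis by simp
qed

text \<open>
  A sum of closed cones need not be closed. Here, in a convergent sequence of sums \<open>P + N\<close>, the
  diagonals of the \<open>P\<close> lie below those of the sums, so the \<open>P\<close> stay bounded and subconverge.
\<close>

lemma closed_psd_plus_nonneg: "closed (psd_cone + nonneg_cone :: (real^'n^'n) set)"
  unfolding closed_sequential_limits
proof (intro allI impI, elim conjE)
  fix M :: "nat \<Rightarrow> real^'n^'n" and L
  assume M: "\<forall>k. M k \<in> psd_cone + nonneg_cone" and lim: "M \<longlonglongrightarrow> L"
  from M have "\<forall>k. \<exists>P N. P \<in> psd_cone \<and> N \<in> nonneg_cone \<and> M k = P + N"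
    by (meson set_plus_elim)
  then obtain P N where P: "\<And>k. P k \<in> psd_cone" and N: "\<And>k. N k \<in> nonneg_cone"
    and eq: "\<And>k. M k = P k + N k" by metis
  have "Bseq M" using lim by (rule convergent_imp_Bseq[OF convergentI])
  then obtain b where b: "\<And>k. norm (M k) \<le> b" by (auto simp: Bseq_def)
  have "P k $ i $ i \<le> b" for k i
  proof -
    have "P k $ i $ i \<le> M k $ i $ i"
      using N[of k] by (simp add: eq nonneg_cone_def)
    also have "\<dots> \<le> norm (M k $ i)"
      using component_le_norm_cart[of "M k $ i" i] by simp
    also have "\<dots> \<le> norm (M k)" by (rule Finite_Cartesian_Product.norm_nth_le)
    finally show ?thesis using b[of k] by simp
  qed
  then have "norm (P k) \<le> of_nat CARD('n) * (of_nat CARD('n) * b)" for k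
    by (intro psd_norm_bound P)
  then have "bounded (range P)"
    unfolding bounded_iff by blast
  then obtain A r where r: "strict_mono r" and A: "(P \<circ> r) \<longlonglongrightarrow> A"
    using bounded_imp_convergent_subsequence by blast
  have "A \<in> psd_cone"
    by (rule closed_sequentially[OF closed_psd_cone _ A]) (simp add: P)
  moreover have "(\<lambda>k. (M \<circ> r) k - (P \<circ> r) k) \<longlonglongrightarrow> L - A"
    by (intro tendsto_diff A LIMSEQ_subseq_LIMSEQ[OF lim r])
  then have "L - A \<in> nonneg_cone"
    by (rule closed_sequentially[OF closed_nonneg_cone, rotated]) (simp add: eq N)
  ultimately show "L \<in> psd_cone + nonneg_cone"
    using set_plus_intro[of A psd_cone "L - A" nonneg_cone] by simp
qed

text \<open>
  A symmetric matrix outside the closed convex cone \<open>psd_cone + nonneg_cone\<close> is strictly separated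
  from it. The symmetric part of the separating functional is doubly nonnegative, as one sees by
  testing it on the matrices \<open>x x\<^sup>T\<close> and on symmetrised matrix units.
\<close>

lemma dn_dual_decomposition:
  fixes M :: "real^'n^'n"
  assumes sym: "M \<in> sym_mats" and dual: "\<And>X. X \<in> dn_cone \<Longrightarrow> 0 \<le> M \<bullet> X"
  shows "M \<in> psd_cone + nonneg_cone"
proof (rule ccontr)
  assume "M \<notin> psd_cone + nonneg_cone"
  then obtain a b where ab: "a \<bullet> M < b" "\<And>X. X \<in> psd_cone + nonneg_cone \<Longrightarrow> b < a \<bullet> X"
    using separating_hyperplane_closed_point
      [OF convex_set_plus[OF convex_psd_cone convex_nonneg_cone] closed_psd_plus_nonneg]
    by blast
  have sub: "X \<in> psd_cone + nonneg_cone" if "X \<in> psd_cone \<or> X \<in> nonneg_cone" for X :: "real^'n^'n"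
    using that set_plus_intro[OF _ zero_nonneg, of X psd_cone]
      set_plus_intro[OF zero_psd, of X nonneg_cone] by auto
  have "b < 0" using ab(2)[OF sub, of 0] by (simp add: zero_psd)
  \<comment> \<open>A functional that is bounded below on a cone is nonnegative there.\<close>
  have nonneg: "0 \<le> a \<bullet> X" if X: "X \<in> psd_cone \<or> X \<in> nonneg_cone" for X
  proof (rule ccontr)
    assume neg: "\<not> 0 \<le> a \<bullet> X"
    then have "0 \<le> b / (a \<bullet> X)" using \<open>b < 0\<close> by (simp add: divide_nonpos_neg)
    then have "(b / (a \<bullet> X)) *\<^sub>R X \<in> psd_cone + nonneg_cone"
      using X psd_scaleR nonneg_scaleR by (intro sub) blast
    from ab(2)[OF this] neg show False by simp
  qed
  define A where "A = (1/2) *\<^sub>R (a + transpose a)"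
  have A_sym: "A \<in> sym_mats" by (simp add: A_def sym_mats_iff transpose_def)
  have A_inner: "A \<bullet> X = a \<bullet> X" if "X \<in> sym_mats" for X
    using that by (simp add: A_def inner_add_left inner_transpose sym_mats_def)
  have "A \<in> psd_cone"
    using nonneg outer_psd A_sym A_inner by (metis psd_cone_iff)
  moreover have A_nonneg: "0 \<le> A $ i $ j" for i j
  proof -
    define U :: "real^'n^'n" where "U = outer (axis i 1) (axis j 1) + outer (axis j 1) (axis i 1)"
    have "U \<in> nonneg_cone"
      by (auto simp: U_def nonneg_cone_def sym_mats_iff axis_def)
    moreover have entry: "a \<bullet> outer (axis k 1) (axis l 1) = a $ k $ l" for k l
      by (simp add: inner_outer inner_axis' matrix_vector_mult_basis column_def)
    then have "a \<bullet> U = 2 * A $ i $ j"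
      by (simp add: U_def A_def transpose_def inner_add_right)
    ultimately show ?thesis using nonneg[of U] by simp
  qed
  ultimately have "A \<in> dn_cone" using A_sym by (simp add: dn_cone_def nonneg_cone_def)
  then have "0 \<le> M \<bullet> A" by (rule dual)
  then show False using ab(1) \<open>b < 0\<close> A_inner[OF sym] by (simp add: inner_commute)
qed

section \<open>Matrices with an exact relaxation\<close>

lemma ones_inner_outer: "x \<in> std_simplex \<Longrightarrow> all_ones_mat \<bullet> outer x x = 1"
  by (simp add: std_simplex_def all_ones_vec_def all_ones_mat_def trace_inner inner_vec_def
      sum_product[symmetric])

lemma outer_ell_feasible:
  assumes "x \<in> std_simplex"
  shows "outer x x \<in> ell_feasible"
  using assms outer_psd[of x] ones_inner_outer[OF assms]
  by (auto simp: ell_feasible_def dn_cone_def nonneg_cone_def psd_cone_def std_simplex_def)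

lemma all_ones_sym: "all_ones_mat \<in> sym_mats"
  by (simp add: sym_mats_iff all_ones_mat_def)

text \<open>
  The relaxation is homogenised by scaling a doubly nonnegative matrix to entry sum one; only the
  zero matrix, whose inner products are zero, cannot be scaled.
\<close>

lemma shifted_inner_dn_nonneg:
  fixes Q X :: "real^'n^'n"
  assumes X: "X \<in> dn_cone"
  shows "0 \<le> (Q - ell Q *\<^sub>R all_ones_mat) \<bullet> X"
proof (cases "all_ones_mat \<bullet> X = 0")
  case True
  have nn: "0 \<le> X $ i $ j" for i j using X by (simp add: dn_cone_def nonneg_cone_def)
  have "X = 0"
    using True nn
    by (simp add: trace_inner all_ones_mat_def sum_nonneg_eq_0_iff sum_nonneg vec_eq_iff)
  then show ?thesis by simp
next
  case False
  define s where "s = all_ones_mat \<bullet> X"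
  have "0 \<le> s"
    unfolding s_def
    using X by (intro nonneg_inner_nonneg) (auto simp: all_ones_mat_def dn_cone_def nonneg_cone_def)
  with False have s: "s > 0" by (simp add: s_def)
  have "(1 / s) *\<^sub>R X \<in> ell_feasible"
    using X s psd_scaleR[of X "1/s"] nonneg_scaleR[of X "1/s"]
    by (auto simp: ell_feasible_def dn_cone_def s_def)
  then have "ell Q \<le> Q \<bullet> ((1 / s) *\<^sub>R X)" using ell_attained[of Q] by auto
  then have "ell Q * s \<le> Q \<bullet> X" using s by (simp add: field_simps)
  then show ?thesis by (simp add: inner_diff_left s_def)
qed

lemma exact_at_imp_decomposition:
  fixes Q :: "real^'n^'n"
  assumes "Q \<in> exact_mats_at x"
  shows "Q \<in> psd_at x + nonneg_at x + ones_line"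
proof -
  have Q: "Q \<in> sym_mats" "ell Q = nu Q" and x: "x \<in> std_simplex" "quad_form Q x = nu Q"
    using assms by (auto simp: exact_mats_at_def argmin_set_def)
  define M where "M = Q - ell Q *\<^sub>R all_ones_mat"
  have "M \<in> sym_mats" using Q(1) all_ones_sym[where 'a='n] by (simp add: M_def sym_mats_iff)
  then have "M \<in> psd_cone + nonneg_cone"
    using dn_dual_decomposition shifted_inner_dn_nonneg M_def by blast
  then obtain P N where P: "P \<in> psd_cone" and N: "N \<in> nonneg_cone" and M: "M = P + N"
    by (rule set_plus_elim)
  have "0 \<le> quad_form P x" using P by (simp add: psd_cone_def)
  moreover have "0 \<le> quad_form N x"
    unfolding quad_form_outer using N x(1)
    by (intro nonneg_inner_nonneg) (auto simp: nonneg_cone_def std_simplex_def)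
  moreover have "quad_form M x = 0"
    using x Q(2) ones_inner_outer[OF x(1)] by (simp add: M_def quad_form_outer inner_diff_left)
  then have "quad_form P x + quad_form N x = 0" by (simp add: M quad_form_add)
  ultimately have "P \<in> psd_at x" "N \<in> nonneg_at x"
    using P N by (auto simp: psd_at_def nonneg_at_def)
  moreover have "ell Q *\<^sub>R all_ones_mat \<in> ones_line" by (auto simp: ones_line_def)
  moreover have "Q = P + N + ell Q *\<^sub>R all_ones_mat"
    using M by (simp add: M_def algebra_simps)
  ultimately show ?thesis by (metis set_plus_intro)
qed

lemma decomposition_imp_exact_at:
  fixes Q :: "real^'n^'n"
  assumes x: "x \<in> std_simplex" and "Q \<in> psd_at x + nonneg_at x + ones_line"
  shows "Q \<in> exact_mats_at x"
proof -
  obtain P N c where P: "P \<in> psd_cone" "quad_form P x = 0" and N: "N \<in> nonneg_cone" "quad_form N x = 0"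
    and Q: "Q = P + N + c *\<^sub>R all_ones_mat"
    using assms(2) by (auto simp: set_plus_def psd_at_def nonneg_at_def ones_line_def)
  have sym: "Q \<in> sym_mats"
    using P N all_ones_sym[where 'a='n] by (simp add: Q psd_cone_def nonneg_cone_def sym_mats_iff)
  have lower: "c \<le> Q \<bullet> X" if X: "X \<in> ell_feasible" for X
  proof -
    have "0 \<le> P \<bullet> X" "0 \<le> N \<bullet> X" "all_ones_mat \<bullet> X = 1"
      using X P N psd_inner_nonneg[of P X] nonneg_inner_nonneg[of N X]
      by (auto simp: ell_feasible_def dn_cone_def nonneg_cone_def)
    then show ?thesis by (simp add: Q inner_add_left)
  qed
  have val: "quad_form Q x = c"
    using P(2) N(2) ones_inner_outer[OF x] by (simp add: Q quad_form_outer inner_add_left)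
  obtain X where X: "X \<in> ell_feasible" "Q \<bullet> X = ell Q" "\<And>Y. Y \<in> ell_feasible \<Longrightarrow> Q \<bullet> X \<le> Q \<bullet> Y"
    using ell_attained by blast
  have "ell Q = c"
    using lower[OF X(1)] X(2) X(3)[OF outer_ell_feasible[OF x]] val
    by (simp add: quad_form_outer)
  moreover obtain y where y: "y \<in> std_simplex" "quad_form Q y = nu Q" "nu Q \<le> quad_form Q x"
    using nu_attained[of Q] x by metis
  then have "nu Q = c"
    using lower[OF outer_ell_feasible[OF y(1)]] val by (simp add: quad_form_outer)
  ultimately show ?thesis using sym x val by (simp add: exact_mats_at_def argmin_set_def)
qed

theorem corollary3p1:
  shows "(exact_mats :: (real^'n^'n) set) = (\<Union>x\<in>std_simplex. exact_mats_at x)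
    \<and> (\<Union>x\<in>std_simplex. exact_mats_at x) =
        (\<Union>x\<in>(std_simplex :: (real^'n) set). psd_at x + nonneg_at x + ones_line)"
proof
  show "(exact_mats :: (real^'n^'n) set) = (\<Union>x\<in>std_simplex. exact_mats_at x)"
    using nu_attained by (fastforce simp: exact_mats_def exact_mats_at_def argmin_set_def)
  show "(\<Union>x\<in>std_simplex. exact_mats_at x) =
        (\<Union>x\<in>(std_simplex :: (real^'n) set). psd_at x + nonneg_at x + ones_line)"
    using exact_at_imp_decomposition decomposition_imp_exact_at by blast
qed

end
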